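(* Let $n$ be an integer with $n\ge 3$ and $n\notin\{2^2,2^3,2^4,\dots\}$, and let $\mathcal{J}(n)\subseteq\mathbb{Q}$ be the finite set defined in the context. Then $\mathcal{J}(n)$ is an arithmetic neighbourhood of $n$ inside $\mathbb{R}$, and so too inside $\mathbb{Q}$; and $\mathcal{J}(n)$ is not an arithmetic neighbourhood of $n$ inside $\mathbb{C}$.
   Context: Let $K$ be a ring (with $1$) and $A\subseteq K$. A map $f:A\to K$ is called arithmetic if: (1) if $1\in A$ then $f(1)=1$; (2) if $a,b\in A$ and $a+b\in A$ then $f(a+b)=f(a)+f(b)$; (3) if $a,b\in A$ and $a\cdot b\in A$ then $f(a\cdot b)=f(a)\cdot f(b)$. (In (2) and (3), $a=b$ is allowed.) A finite set $A\subseteq K$ with $r\in A$ is an arithmetic neighbourhood of $r$ inside $K$ if every arithmetic map $f:A\to K$ satisfies $f(r)=r$. Definition of $\mathcal{J}(n)$: let $n\ge 3$ be an integer with $n\notin\{2^2,2^3,2^4,\dots\}$. Let $\rho(n)$ be the smallest integer such that $n^3\le 2^{\rho(n)}$. Then $n^3\le 2^{\rho(n)}<n^4$, so $2^{\rho(n)}$ has exactly four digits in base $n$; write $$2^{\rho(n)}=m_3 n^3+m_2 n^2+m_1 n+m_0,$$ with $m_3\in\{1,2,\dots,n-1\}$ and $m_2,m_1,m_0\in\{0,1,2,\dots,n-1\}$. Put $$\begin{aligned}\mathcal{J}(n)=&\left\{-1,\,0,\,1,\,-\tfrac12,\,-\tfrac1{2^2},\,-\tfrac1{2^3},\dots,-\tfrac1{2^{\rho(n)}},\,n,\,n^2\right\}\\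 &\cup\{k n^3: k\in\{1,2,\dots,m_3\}\}\\ &\cup\{m_3n^3+k n^2: k\in\{1,2,\dots,m_2\}\}\\ &\cup\{m_3n^3+m_2n^2+k n: k\in\{1,2,\dots,m_1\}\}\\ &\cup\{m_3n^3+m_2n^2+m_1n+k: k\in\{1,2,\dots,m_0\}\},\end{aligned}$$ where $\{1,2,\dots,m\}$ is empty when $m=0$. *)

theory Defs
  imports Complex_Main
begin

text \<open>The ring \<open>K\<close> is the type \<open>'a\<close>. A map \<open>A \<rightarrow> K\<close> is represented by a total function,
  of which only the values on \<open>A\<close> are ever constrained or inspected.\<close>

definition arithmetic_map :: "'a::ring_1 set \<Rightarrow> ('a \<Rightarrow> 'a) \<Rightarrow> bool" where
  "arithmetic_map A f \<longleftrightarrow>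
     (1 \<in> A \<longrightarrow> f 1 = 1) \<and>
     (\<forall>a\<in>A. \<forall>b\<in>A. a + b \<in> A \<longrightarrow> f (a + b) = f a + f b) \<and>
     (\<forall>a\<in>A. \<forall>b\<in>A. a * b \<in> A \<longrightarrow> f (a * b) = f a * f b)"

definition arithmetic_neighbourhood :: "'a::ring_1 set \<Rightarrow> 'a \<Rightarrow> bool" where
  "arithmetic_neighbourhood A r \<longleftrightarrow>
     finite A \<and> r \<in> A \<and> (\<forall>f. arithmetic_map A f \<longrightarrow> f r = r)"

text \<open>For \<open>n \<ge> 3\<close> every integer exponent \<open>e\<close> with \<open>n ^ 3 \<le> 2 ^ e\<close> is positive, so the least
  such exponent may be sought among the natural numbers.\<close>

definition rho :: "int \<Rightarrow> nat" where
  "rho n = (LEAST e. n ^ 3 \<le> 2 ^ e)"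

text \<open>The coefficient of \<open>n ^ i\<close> in the base-\<open>n\<close> expansion of \<open>2 ^ rho n\<close>; see
  \<open>rho_expansion\<close> and \<open>rho_expansion_unique\<close> below.\<close>

definition dig :: "int \<Rightarrow> nat \<Rightarrow> int" where
  "dig n i = 2 ^ rho n div n ^ i mod n"

definition J :: "int \<Rightarrow> rat set" where
  "J n = (let m0 = dig n 0; m1 = dig n 1; m2 = dig n 2; m3 = dig n 3 in
     {-1, 0, 1} \<union> {- (1 / 2 ^ i) | i. i \<in> {1..rho n}} \<union> {of_int n, of_int (n ^ 2)}
     \<union> {of_int (k * n ^ 3) | k. k \<in> {1..m3}}
     \<union> {of_int (m3 * n ^ 3 + k * n ^ 2) | k. k \<in> {1..m2}}
     \<union> {of_int (m3 * n ^ 3 + m2 * n ^ 2 + k * n) | k. k \<in> {1..m1}}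
     \<union> {of_int (m3 * n ^ 3 + m2 * n ^ 2 + m1 * n + k) | k. k \<in> {1..m0}})"

lemma rho_bounds:
  assumes "n \<ge> 3"
  shows "n ^ 3 \<le> 2 ^ rho n" and "2 ^ rho n < n ^ 4"
proof -
  obtain e where "n ^ 3 < 2 ^ e"
  proof -
    have "n ^ 3 < 2 ^ nat (n ^ 3)"
      using of_nat_less_two_power[of "nat (n ^ 3)", where ?'a = int] assms by simp
    then show ?thesis by (rule that)
  qed
  then have "n ^ 3 \<le> 2 ^ e" by simp
  then show le: "n ^ 3 \<le> 2 ^ rho n"
    unfolding rho_def by (rule LeastI)
  have "1 < n ^ 3" using assms by (simp add: one_less_power)
  with le have "rho n \<noteq> 0" by (intro notI) simp
  then obtain r where r: "rho n = Suc r" by (cases "rho n") auto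
  then have "\<not> n ^ 3 \<le> 2 ^ r"
    unfolding rho_def by (metis lessI not_less_Least)
  then have "2 ^ rho n < 2 * n ^ 3" by (simp add: r)
  also have "\<dots> \<le> n * n ^ 3"
    using assms by (intro mult_right_mono) auto
  also have "\<dots> = n ^ 4" by (simp add: eval_nat_numeral)
  finally show "2 ^ rho n < n ^ 4" .
qed

lemma rho_expansion_unique:
  fixes n :: int
  assumes "2 ^ rho n = m3 * n ^ 3 + m2 * n ^ 2 + m1 * n + m0"
    and "m3 \<in> {0..<n}" "m2 \<in> {0..<n}" "m1 \<in> {0..<n}" "m0 \<in> {0..<n}"
  shows "m3 = dig n 3" "m2 = dig n 2" "m1 = dig n 1" "m0 = dig n 0"
proof -
  have n: "n > 0" using assms by auto
  have e: "2 ^ rho n = m0 + n * (m1 + n * (m2 + n * m3))"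
    using assms(1) by (simp add: algebra_simps eval_nat_numeral)
  have d1: "2 ^ rho n div n = m1 + n * (m2 + n * m3)"
    using n assms(2-) unfolding e by simp
  have d2: "2 ^ rho n div n ^ 2 = m2 + n * m3"
    using n assms(2-) d1 by (simp add: power2_eq_square zdiv_zmult2_eq)
  have d3: "2 ^ rho n div n ^ 3 = m3"
  proof -
    have "2 ^ rho n div n ^ 3 = 2 ^ rho n div n ^ 2 div n"
      using n by (simp add: power2_eq_square power3_eq_cube zdiv_zmult2_eq)
    then show ?thesis using n assms(2-) d2 by simp
  qed
  show "m3 = dig n 3" "m2 = dig n 2" "m1 = dig n 1"
    using n assms(2-) d1 d2 d3 by (simp_all add: dig_def)
  show "m0 = dig n 0" using assms(2-) e by (simp add: dig_def)
qed

lemma rho_expansion: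
  assumes "n \<ge> 3"
  shows "2 ^ rho n = dig n 3 * n ^ 3 + dig n 2 * n ^ 2 + dig n 1 * n + dig n 0"
    and "dig n 3 \<in> {1..n - 1}"
    and "dig n 2 \<in> {0..n - 1}" "dig n 1 \<in> {0..n - 1}" "dig n 0 \<in> {0..n - 1}"
proof -
  define N :: int where "N = 2 ^ rho n"
  have n: "n > 0" using assms by simp
  have b: "n ^ 3 \<le> N" "N < n * n ^ 3"
    using rho_bounds[OF assms] by (simp_all add: N_def eval_nat_numeral)
  have lo: "N div n ^ 3 \<ge> 1" using n b by (simp add: pos_imp_zdiv_pos_iff int_one_le_iff_zero_less)
  have hi: "N div n ^ 3 < n"
  proof -
    have "(N div n ^ 3) * n ^ 3 \<le> N"
      using n div_mult_mod_eq[of N "n ^ 3"] pos_mod_sign[of "n ^ 3" N]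
      by (smt (verit) zero_less_power)
    then have "(N div n ^ 3) * n ^ 3 < n * n ^ 3" using b by linarith
    then show ?thesis using n by (simp add: mult_less_cancel_right)
  qed
  have top: "dig n 3 = N div n ^ 3" using lo hi by (simp add: dig_def N_def)
  show "dig n 3 \<in> {1..n - 1}" using lo hi top by simp
  show "dig n 2 \<in> {0..n - 1}" "dig n 1 \<in> {0..n - 1}" "dig n 0 \<in> {0..n - 1}"
    using n by (simp_all add: dig_def)
  have d2: "N div n ^ 2 = N div n div n" and d3: "N div n ^ 3 = N div n div n div n"
    using n by (simp_all add: power2_eq_square power3_eq_cube zdiv_zmult2_eq)
  have "N = n * (N div n) + N mod n" by simp
  also have "N div n = n * (N div n div n) + N div n mod n" by simp
  also have "N div n div n = n * (N div n div n div n) + N div n div n mod n" by simp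
  finally have "N = n * (n * (n * (N div n div n div n) + N div n div n mod n) + N div n mod n) + N mod n" .
  then have "N = n * (n * (n * dig n 3 + dig n 2) + dig n 1) + dig n 0"
    using top d2 d3 by (simp add: dig_def N_def)
  then show "2 ^ rho n = dig n 3 * n ^ 3 + dig n 2 * n ^ 2 + dig n 1 * n + dig n 0"
    unfolding N_def by (simp add: algebra_simps power2_eq_square power3_eq_cube)
qed

end

theory Submission
  imports Defs "HOL-Computational_Algebra.Primes"
begin

text \<open>
  Write \<open>m\<^sub>3, \<dots>, m\<^sub>0\<close> for the base-\<open>n\<close> digits of \<open>2 ^ rho n\<close>. Over every field of characteristic
  zero, the possible values \<open>x\<close> of an arithmetic map at \<open>n\<close> are exactly the solutions of the
  digit equation \<open>m\<^sub>3 x\<^sup>3 + m\<^sub>2 x\<^sup>2 + m\<^sub>1 x + m\<^sub>0 = 2 ^ rho n\<close>.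

  Such a value is a solution (\<open>digit_equation_of_arithmetic_map\<close>) because the integers of \<open>J n\<close>
  lead from \<open>n\<close> to \<open>2 ^ rho n\<close> in steps of \<open>n\<^sup>3\<close>, \<open>n\<^sup>2\<close>, \<open>n\<close> and \<open>1\<close>, so that the map sends
  \<open>2 ^ rho n\<close> to the left-hand side. On the other hand the map fixes \<open>-1\<close>, hence by repeated
  halving also \<open>- (1 / 2 ^ rho n)\<close>; the product of this number with \<open>2 ^ rho n\<close> is \<open>-1\<close>, so
  \<open>2 ^ rho n\<close> is fixed too.

  Conversely (\<open>arithmetic_map_of_digit_equation\<close>) a solution \<open>x\<close> gives the map that fixes the
  negative elements and replaces the base \<open>n\<close> by \<open>x\<close> in the digit expansion of the others. It is
  additive because no sum inside \<open>J n\<close> produces a carry: a carry would lead beyond \<open>2 ^ rho n\<close>.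
  Among the products, only those of a negative dyadic fraction and a positive integer \<open>s\<close> are
  delicate. If such a product lies in \<open>J n\<close>, then \<open>s\<close> is a power of two, and since \<open>n\<close> is not
  one, \<open>s\<close> can only be \<open>1\<close> or \<open>2 ^ rho n\<close>; both are fixed, the latter by the digit equation.

  Finally, \<open>n\<close> is a root of the cubic, and the remaining quadratic factor has negative discriminant
  because \<open>m\<^sub>2 < n\<close> and \<open>m\<^sub>3 \<ge> 1\<close>. Hence \<open>n\<close> is the only solution in an ordered field,
  whereas the complex numbers contain another one.
\<close>

section \<open>Arithmetic maps on J(n) satisfy the digit equation\<close>

definition digit_equation :: "int \<Rightarrow> 'a::field_char_0 \<Rightarrow> bool" where
  "digit_equation n x \<longleftrightarrow>
     of_int (dig n 3) * x ^ 3 + of_int (dig n 2) * x ^ 2 + of_int (dig n 1) * x + of_int (dig n 0)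
       = 2 ^ rho n"

lemma arithmetic_map_add:
  "arithmetic_map A f \<Longrightarrow> a \<in> A \<Longrightarrow> b \<in> A \<Longrightarrow> a + b \<in> A \<Longrightarrow> f (a + b) = f a + f b"
  by (simp add: arithmetic_map_def)

lemma arithmetic_map_mult:
  "arithmetic_map A f \<Longrightarrow> a \<in> A \<Longrightarrow> b \<in> A \<Longrightarrow> a * b \<in> A \<Longrightarrow> f (a * b) = f a * f b"
  by (simp add: arithmetic_map_def)

lemma arithmetic_map_0:
  assumes "arithmetic_map A f" "0 \<in> A"
  shows "f 0 = 0"
  using arithmetic_map_add[OF assms(1), of 0 0] assms(2) by simp

text \<open>This lemma is applied once for each digit of \<open>2 ^ rho n\<close>. Membership of the end point is part
  of the conclusion because the end point is where the next progression starts; for a zero digit it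
  coincides with \<open>u\<close>.\<close>

lemma arithmetic_map_progression:
  fixes s u :: "'a::ring_1" and m :: int
  assumes f: "arithmetic_map A f" and s: "s \<in> A" and u: "u \<in> A" and "m \<ge> 0"
    and steps: "\<And>k. k \<in> {1..m} \<Longrightarrow> u + of_int k * s \<in> A"
  shows "u + of_int m * s \<in> A \<and> f (u + of_int m * s) = f u + of_int m * f s"
  using \<open>m \<ge> 0\<close> steps
proof (induction m rule: int_ge_induct)
  case base
  then show ?case using u by simp
next
  case (step i)
  then have ih: "u + of_int i * s \<in> A" "f (u + of_int i * s) = f u + of_int i * f s"
    by auto
  have in': "u + of_int (i + 1) * s \<in> A"
    using step.prems[of "i + 1"] step.hyps by simp
  have eq: "u + of_int (i + 1) * s = (u + of_int i * s) + s"
    by (simp add: algebra_simps)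
  show ?case
    using arithmetic_map_add[OF f ih(1) s] in' ih(2) unfolding eq
    by (simp add: algebra_simps)
qed

text \<open>From \<open>-1 + 1 = 0\<close> the map fixes \<open>-1\<close>, and every further element is half of its
  predecessor.\<close>

lemma arithmetic_map_neg_half_powers:
  fixes f :: "'a::field_char_0 \<Rightarrow> 'a"
  assumes f: "arithmetic_map A f" and "0 \<in> A" "1 \<in> A"
    and mem: "\<And>i. i \<le> r \<Longrightarrow> - (1 / 2 ^ i) \<in> A"
    and "i \<le> r"
  shows "f (- (1 / 2 ^ i)) = - (1 / 2 ^ i)"
  using \<open>i \<le> r\<close>
proof (induction i)
  case 0
  have "f (- 1 + 1) = f (- 1) + f 1"
    using mem[of 0] assms(2,3) by (intro arithmetic_map_add[OF f]) auto
  moreover have "f 1 = 1" using f assms(3) by (simp add: arithmetic_map_def)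
  ultimately show ?case
    using arithmetic_map_0[OF f assms(2)] by (simp add: add_eq_0_iff2)
next
  case (Suc i)
  have eq: "- (1 / 2 ^ Suc i) + - (1 / 2 ^ Suc i) = (- (1 / 2 ^ i) :: 'a)"
    by (simp add: field_simps)
  have "f (- (1 / 2 ^ Suc i)) + f (- (1 / 2 ^ Suc i)) = f (- (1 / 2 ^ i))"
    using arithmetic_map_add[OF f mem[OF Suc.prems] mem[OF Suc.prems]] mem[of i] Suc.prems
    unfolding eq by simp
  also have "\<dots> = - (1 / 2 ^ i)" using Suc by simp
  finally have "2 * f (- (1 / 2 ^ Suc i)) = - (1 / 2 ^ i)" by simp
  then show ?case by (simp add: field_simps)
qed

lemma digit_equation_of_arithmetic_map:
  fixes f :: "'a::field_char_0 \<Rightarrow> 'a"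
  assumes n: "n \<ge> 3" and f: "arithmetic_map (of_rat ` J n) f"
  shows "digit_equation n (f (of_int n))"
proof -
  let ?A = "of_rat ` J n :: 'a set"
  let ?m0 = "dig n 0" and ?m1 = "dig n 1" and ?m2 = "dig n 2" and ?m3 = "dig n 3"
  note digits = rho_expansion[OF n]
  have int_mem: "of_int t \<in> ?A" if "of_int t \<in> J n" for t
    using that by (metis imageI of_rat_of_int_eq)
  have "0 \<in> J n" "1 \<in> J n" by (simp_all add: J_def Let_def)
  then have "0 \<in> ?A" "1 \<in> ?A" using int_mem[of 0] int_mem[of 1] by simp_all
  moreover have "of_int n \<in> J n" "of_int (n ^ 2) \<in> J n"
    "\<And>k. k \<in> {1..?m3} \<Longrightarrow> of_int (k * n ^ 3) \<in> J n"
    "\<And>k. k \<in> {1..?m2} \<Longrightarrow> of_int (?m3 * n ^ 3 + k * n ^ 2) \<in> J n"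
    "\<And>k. k \<in> {1..?m1} \<Longrightarrow> of_int (?m3 * n ^ 3 + ?m2 * n ^ 2 + k * n) \<in> J n"
    "\<And>k. k \<in> {1..?m0} \<Longrightarrow> of_int (?m3 * n ^ 3 + ?m2 * n ^ 2 + ?m1 * n + k) \<in> J n"
    unfolding J_def Let_def by blast+
  ultimately have mem:
    "0 \<in> ?A" "1 \<in> ?A" "of_int n \<in> ?A" "of_int (n ^ 2) \<in> ?A"
    "\<And>k. k \<in> {1..?m3} \<Longrightarrow> of_int (k * n ^ 3) \<in> ?A"
    "\<And>k. k \<in> {1..?m2} \<Longrightarrow> of_int (?m3 * n ^ 3 + k * n ^ 2) \<in> ?A"
    "\<And>k. k \<in> {1..?m1} \<Longrightarrow> of_int (?m3 * n ^ 3 + ?m2 * n ^ 2 + k * n) \<in> ?A"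
    "\<And>k. k \<in> {1..?m0} \<Longrightarrow> of_int (?m3 * n ^ 3 + ?m2 * n ^ 2 + ?m1 * n + k) \<in> ?A"
    by (blast intro: int_mem)+
  have half_mem: "- (1 / 2 ^ i) \<in> ?A" if "i \<le> rho n" for i
  proof -
    have "- (1 / 2 ^ i) \<in> J n" using that by (cases "i = 0") (auto simp: J_def Let_def)
    from imageI[OF this, of "of_rat :: rat \<Rightarrow> 'a"] show ?thesis
      by (simp add: of_rat_minus of_rat_divide of_rat_power)
  qed
  define x where "x = f (of_int n)"
  have f0: "f 0 = 0" using arithmetic_map_0[OF f mem(1)] .
  have f1: "f 1 = 1" using f mem(2) by (simp add: arithmetic_map_def)
  have sq: "f (of_int (n ^ 2)) = x ^ 2"
    using arithmetic_map_mult[OF f mem(3) mem(3)] mem(4) by (simp add: x_def power2_eq_square)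
  have cube_mem: "of_int (n ^ 3) \<in> ?A" using mem(5)[of 1] digits(2) by simp
  have cube: "f (of_int (n ^ 3)) = x ^ 3"
    using arithmetic_map_mult[OF f mem(3) mem(4)] cube_mem sq
    by (simp add: x_def power2_eq_square power3_eq_cube mult.assoc)
  have s3: "of_int (?m3 * n ^ 3) \<in> ?A \<and> f (of_int (?m3 * n ^ 3)) = of_int ?m3 * x ^ 3"
    using arithmetic_map_progression[OF f cube_mem mem(1), of ?m3] mem(5) digits(2) f0 cube
    by simp
  have s2: "of_int (?m3 * n ^ 3 + ?m2 * n ^ 2) \<in> ?A \<and>
      f (of_int (?m3 * n ^ 3 + ?m2 * n ^ 2)) = of_int ?m3 * x ^ 3 + of_int ?m2 * x ^ 2"
    using arithmetic_map_progression[OF f mem(4) conjunct1[OF s3], of ?m2] mem(6) digits(3) s3 sq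
    by simp
  have s1: "of_int (?m3 * n ^ 3 + ?m2 * n ^ 2 + ?m1 * n) \<in> ?A \<and>
      f (of_int (?m3 * n ^ 3 + ?m2 * n ^ 2 + ?m1 * n))
        = of_int ?m3 * x ^ 3 + of_int ?m2 * x ^ 2 + of_int ?m1 * x"
    using arithmetic_map_progression[OF f mem(3) conjunct1[OF s2], of ?m1] mem(7) digits(4) s2
    by (simp add: x_def)
  have s0: "of_int (2 ^ rho n) \<in> ?A \<and> f (of_int (2 ^ rho n))
        = of_int ?m3 * x ^ 3 + of_int ?m2 * x ^ 2 + of_int ?m1 * x + of_int ?m0"
    using arithmetic_map_progression[OF f mem(2) conjunct1[OF s1], of ?m0] mem(8) digits(5) s1 f1
    unfolding digits(1) by simp
  have "f (2 ^ rho n * - (1 / 2 ^ rho n)) = f (2 ^ rho n) * f (- (1 / 2 ^ rho n))"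
    using s0 half_mem[of 0] half_mem[of "rho n"] by (intro arithmetic_map_mult[OF f]) auto
  moreover have "f (- (1 / 2 ^ i)) = - (1 / 2 ^ i)" if "i \<le> rho n" for i
    using arithmetic_map_neg_half_powers[OF f mem(1,2) half_mem] that by blast
  from this[of 0] this[of "rho n"] have "f (- 1) = - 1" "f (- (1 / 2 ^ rho n)) = - (1 / 2 ^ rho n)"
    by simp_all
  ultimately have "f (2 ^ rho n) = 2 ^ rho n" by (simp add: field_simps)
  with s0 show ?thesis by (simp add: digit_equation_def x_def)
qed

section \<open>Solutions of the digit equation come from arithmetic maps\<close>

text \<open>The elements of \<open>J n\<close> from \<open>n ^ 3\<close> on, given by their base-\<open>n\<close> digits: digits may be lowered
  from those of \<open>2 ^ rho n\<close>, but a nonzero digit forces all higher digits to be the full ones. This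
  single description replaces the four progressions of \<open>J n\<close> and is what excludes carries.\<close>

definition truncations :: "int \<Rightarrow> int set" where
  "truncations n = {a * n ^ 3 + b * n ^ 2 + c * n + d | a b c d.
     1 \<le> a \<and> a \<le> dig n 3 \<and> 0 \<le> b \<and> b \<le> dig n 2 \<and> 0 \<le> c \<and> c \<le> dig n 1 \<and> 0 \<le> d \<and> d \<le> dig n 0 \<and>
     (b \<noteq> 0 \<longrightarrow> a = dig n 3) \<and>
     (c \<noteq> 0 \<longrightarrow> a = dig n 3 \<and> b = dig n 2) \<and>
     (d \<noteq> 0 \<longrightarrow> a = dig n 3 \<and> b = dig n 2 \<and> c = dig n 1)}"

lemma truncationsE:
  assumes "t \<in> truncations n"
  obtains a b c d where "t = a * n ^ 3 + b * n ^ 2 + c * n + d"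
    "1 \<le> a" "a \<le> dig n 3" "0 \<le> b" "b \<le> dig n 2" "0 \<le> c" "c \<le> dig n 1" "0 \<le> d" "d \<le> dig n 0"
    "b \<noteq> 0 \<longrightarrow> a = dig n 3"
    "c \<noteq> 0 \<longrightarrow> a = dig n 3 \<and> b = dig n 2"
    "d \<noteq> 0 \<longrightarrow> a = dig n 3 \<and> b = dig n 2 \<and> c = dig n 1"
  using assms unfolding truncations_def by blast

definition J_nonneg :: "int \<Rightarrow> int set" where
  "J_nonneg n = {0, 1, n, n ^ 2} \<union> truncations n"

lemma J_subset:
  assumes n: "n \<ge> 3"
  shows "J n \<subseteq> of_int ` J_nonneg n \<union> (\<lambda>i. - (1 / 2 ^ i)) ` {..rho n}"
proof -
  note digits = rho_expansion[OF n]
  let ?m0 = "dig n 0" and ?m1 = "dig n 1" and ?m2 = "dig n 2" and ?m3 = "dig n 3"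
  have t3: "k * n ^ 3 \<in> truncations n" if "k \<in> {1..?m3}" for k
    unfolding truncations_def mem_Collect_eq
    by (rule exI[of _ k], rule exI[of _ 0], rule exI[of _ 0], rule exI[of _ 0])
      (use that digits in auto)
  have t2: "?m3 * n ^ 3 + k * n ^ 2 \<in> truncations n" if "k \<in> {1..?m2}" for k
    unfolding truncations_def mem_Collect_eq
    by (rule exI[of _ ?m3], rule exI[of _ k], rule exI[of _ 0], rule exI[of _ 0])
      (use that digits in auto)
  have t1: "?m3 * n ^ 3 + ?m2 * n ^ 2 + k * n \<in> truncations n" if "k \<in> {1..?m1}" for k
    unfolding truncations_def mem_Collect_eq
    by (rule exI[of _ ?m3], rule exI[of _ ?m2], rule exI[of _ k], rule exI[of _ 0])
      (use that digits in auto)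
  have t0: "?m3 * n ^ 3 + ?m2 * n ^ 2 + ?m1 * n + k \<in> truncations n" if "k \<in> {1..?m0}" for k
    unfolding truncations_def mem_Collect_eq
    by (rule exI[of _ ?m3], rule exI[of _ ?m2], rule exI[of _ ?m1], rule exI[of _ k])
      (use that digits in auto)
  have neg: "- (1 / 2 ^ i) \<in> (\<lambda>i. - (1 / 2 ^ i) :: rat) ` {..rho n}" if "i \<le> rho n" for i
    using that by blast
  have "of_int ` {0, 1, n, n ^ 2} \<subseteq> (of_int ` J_nonneg n :: rat set)"
    and "of_int ` truncations n \<subseteq> (of_int ` J_nonneg n :: rat set)"
    by (auto simp: J_nonneg_def)
  then show ?thesis
    unfolding J_def Let_def
    using neg[of 0] t3 t2 t1 t0 neg
    by (auto simp del: of_int_add of_int_mult of_int_power)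
qed

lemma truncations_bounds:
  assumes n: "n \<ge> 3" and t: "t \<in> truncations n"
  shows "n ^ 3 \<le> t" "t \<le> 2 ^ rho n"
proof -
  from t obtain a b c d where t: "t = a * n ^ 3 + b * n ^ 2 + c * n + d"
    and d: "1 \<le> a" "a \<le> dig n 3" "0 \<le> b" "b \<le> dig n 2" "0 \<le> c" "c \<le> dig n 1"
      "0 \<le> d" "d \<le> dig n 0"
    by (elim truncationsE)
  have "1 * n ^ 3 \<le> a * n ^ 3" "0 \<le> b * n ^ 2" "0 \<le> c * n"
    using n d by (auto intro: mult_right_mono)
  then show "n ^ 3 \<le> t" using d t by linarith
  have "a * n ^ 3 \<le> dig n 3 * n ^ 3" "b * n ^ 2 \<le> dig n 2 * n ^ 2" "c * n \<le> dig n 1 * n"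
    using n d by (auto intro: mult_right_mono)
  then show "t \<le> 2 ^ rho n" using d t rho_expansion(1)[OF n] by linarith
qed

definition eval_digits :: "int \<Rightarrow> 'a::field_char_0 \<Rightarrow> int \<Rightarrow> 'a" where
  "eval_digits n x t = of_int (t div n ^ 3) * x ^ 3 + of_int (t div n ^ 2 mod n) * x ^ 2
     + of_int (t div n mod n) * x + of_int (t mod n)"

text \<open>The leading coefficient \<open>a\<close> is not restricted to digits, since nothing is reduced modulo \<open>n\<close>
  there.\<close>

lemma eval_digits_eq:
  assumes "b \<in> {0..<n}" "c \<in> {0..<n}" "d \<in> {0..<n}"
  shows "eval_digits n x (a * n ^ 3 + b * n ^ 2 + c * n + d)
    = of_int a * x ^ 3 + of_int b * x ^ 2 + of_int c * x + of_int d"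
proof -
  define t where "t = a * n ^ 3 + b * n ^ 2 + c * n + d"
  have n: "n > 0" using assms by auto
  have t: "t = d + n * (c + n * (b + n * a))"
    by (simp add: t_def algebra_simps eval_nat_numeral)
  have d1: "t div n = c + n * (b + n * a)" using n assms unfolding t by simp
  have d2: "t div n ^ 2 = b + n * a"
    using n assms d1 by (simp add: power2_eq_square zdiv_zmult2_eq)
  have d3: "t div n ^ 3 = a"
  proof -
    have "t div n ^ 3 = t div n ^ 2 div n"
      using n by (simp add: power2_eq_square power3_eq_cube zdiv_zmult2_eq)
    then show ?thesis using n assms d2 by simp
  qed
  have "t mod n = d" using assms t by simp
  then show ?thesis
    unfolding t_def[symmetric] eval_digits_def d1 d2 d3 using assms by simp
qed

lemma eval_digits_basic:
  assumes n: "n \<ge> 3"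
  shows "eval_digits n x 0 = 0" "eval_digits n x 1 = 1" "eval_digits n x n = x"
    "eval_digits n x (n ^ 2) = x ^ 2" "eval_digits n x (a * n ^ 3) = of_int a * x ^ 3"
  using n eval_digits_eq[of 0 n 0 0 x 0] eval_digits_eq[of 0 n 0 1 x 0]
    eval_digits_eq[of 0 n 1 0 x 0] eval_digits_eq[of 1 n 0 0 x 0] eval_digits_eq[of 0 n 0 0 x a]
  by simp_all

lemma eval_digits_rho:
  assumes n: "n \<ge> 3" and x: "digit_equation n x"
  shows "eval_digits n x (2 ^ rho n) = 2 ^ rho n"
  using x rho_expansion[OF n] eval_digits_eq[of "dig n 2" n "dig n 1" "dig n 0" x "dig n 3"]
  by (simp add: digit_equation_def)

text \<open>Digit evaluation is additive as long as no carry occurs. A carry in some position would need the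
  digit \<open>n - 1\<close> there, which is then the full, nonzero digit of \<open>2 ^ rho n\<close>; so all higher digits
  of \<open>t\<close> are full as well, and increasing the digit already exceeds \<open>2 ^ rho n\<close>. Two truncations
  have a sum within the bound only if both leading digits are below \<open>dig n 3\<close>, and then both are
  multiples of \<open>n ^ 3\<close>.\<close>

lemma eval_digits_add_truncation:
  assumes n: "n \<ge> 3" and t: "t \<in> truncations n"
    and s: "s \<in> {0, 1, n, n ^ 2} \<union> truncations n" and le: "s + t \<le> 2 ^ rho n"
  shows "eval_digits n x (s + t) = eval_digits n x s + eval_digits n x t"
proof -
  note digits = rho_expansion[OF n]
  note basic = eval_digits_basic[OF n, of x]
  from t obtain a b c d where t: "t = a * n ^ 3 + b * n ^ 2 + c * n + d"
    and d: "1 \<le> a" "a \<le> dig n 3" "0 \<le> b" "b \<le> dig n 2" "0 \<le> c" "c \<le> dig n 1"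
      "0 \<le> d" "d \<le> dig n 0"
    and full: "b \<noteq> 0 \<longrightarrow> a = dig n 3" "c \<noteq> 0 \<longrightarrow> a = dig n 3 \<and> b = dig n 2"
      "d \<noteq> 0 \<longrightarrow> a = dig n 3 \<and> b = dig n 2 \<and> c = dig n 1"
    by (rule truncationsE)
  have lt: "b < n" "c < n" "d < n" using d digits by auto
  have evt: "eval_digits n x t = of_int a * x ^ 3 + of_int b * x ^ 2 + of_int c * x + of_int d"
    unfolding t using d lt by (intro eval_digits_eq) auto
  have tail1: "dig n 0 < n" using digits by simp
  have "dig n 1 * n \<le> (n - 1) * n" using n digits by (intro mult_right_mono) auto
  then have tail2: "dig n 1 * n + dig n 0 < n ^ 2"
    using tail1 by (simp add: algebra_simps power2_eq_square)
  have "dig n 2 * n ^ 2 \<le> (n - 1) * n ^ 2" using n digits by (intro mult_right_mono) auto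
  then have tail3: "dig n 2 * n ^ 2 + dig n 1 * n + dig n 0 < n ^ 3"
    using tail2 by (simp add: algebra_simps power2_eq_square power3_eq_cube)
  consider "s = 0" | "s = 1" | "s = n" | "s = n ^ 2" | "s \<in> truncations n"
    using s by auto
  then show ?thesis
  proof cases
    case 1
    then show ?thesis by (simp add: eval_digits_basic[OF n])
  next
    case 2
    have "d + 1 \<noteq> n"
    proof
      assume *: "d + 1 = n"
      then have "d = dig n 0" "d \<noteq> 0" using d digits n by auto
      then have "t = 2 ^ rho n" using full t digits by simp
      then show False using le 2 by simp
    qed
    then have "eval_digits n x (a * n ^ 3 + b * n ^ 2 + c * n + (d + 1))
        = of_int a * x ^ 3 + of_int b * x ^ 2 + of_int c * x + of_int (d + 1)"
      using d lt by (intro eval_digits_eq) auto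
    moreover have "s + t = a * n ^ 3 + b * n ^ 2 + c * n + (d + 1)"
      using t 2 by simp
    ultimately have "eval_digits n x (s + t)
        = of_int a * x ^ 3 + of_int b * x ^ 2 + of_int c * x + of_int (d + 1)"
      by simp
    then show ?thesis
      unfolding evt using basic 2 by (simp add: algebra_simps)
  next
    case 3
    have "c + 1 \<noteq> n"
    proof
      assume *: "c + 1 = n"
      then have "c = dig n 1" "c \<noteq> 0" using d digits n by auto
      then have "t = dig n 3 * n ^ 3 + dig n 2 * n ^ 2 + dig n 1 * n + d" using full t by simp
      then show False using le 3 tail1 d digits(1) by simp
    qed
    then have "eval_digits n x (a * n ^ 3 + b * n ^ 2 + (c + 1) * n + d)
        = of_int a * x ^ 3 + of_int b * x ^ 2 + of_int (c + 1) * x + of_int d"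
      using d lt by (intro eval_digits_eq) auto
    moreover have "s + t = a * n ^ 3 + b * n ^ 2 + (c + 1) * n + d"
      using t 3 by (simp add: algebra_simps)
    ultimately have "eval_digits n x (s + t)
        = of_int a * x ^ 3 + of_int b * x ^ 2 + of_int (c + 1) * x + of_int d"
      by simp
    then show ?thesis
      unfolding evt using basic 3 by (simp add: algebra_simps)
  next
    case 4
    have "b + 1 \<noteq> n"
    proof
      assume *: "b + 1 = n"
      then have "b = dig n 2" "b \<noteq> 0" using d digits n by auto
      then have "t = dig n 3 * n ^ 3 + dig n 2 * n ^ 2 + c * n + d" using full t by simp
      moreover have "0 \<le> c * n" using d n by simp
      ultimately show False using le 4 tail2 d digits(1) by simp
    qed
    then have "eval_digits n x (a * n ^ 3 + (b + 1) * n ^ 2 + c * n + d)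
        = of_int a * x ^ 3 + of_int (b + 1) * x ^ 2 + of_int c * x + of_int d"
      using d lt by (intro eval_digits_eq) auto
    moreover have "s + t = a * n ^ 3 + (b + 1) * n ^ 2 + c * n + d"
      using t 4 by (simp add: algebra_simps)
    ultimately have "eval_digits n x (s + t)
        = of_int a * x ^ 3 + of_int (b + 1) * x ^ 2 + of_int c * x + of_int d"
      by simp
    then show ?thesis
      unfolding evt using basic 4 by (simp add: algebra_simps)
  next
    case 5
    then obtain a' b' c' d' where s': "s = a' * n ^ 3 + b' * n ^ 2 + c' * n + d'"
      and d': "1 \<le> a'" "a' \<le> dig n 3" "0 \<le> b'" "b' \<le> dig n 2" "0 \<le> c'" "c' \<le> dig n 1"
        "0 \<le> d'" "d' \<le> dig n 0"
      and full': "b' \<noteq> 0 \<longrightarrow> a' = dig n 3" "c' \<noteq> 0 \<longrightarrow> a' = dig n 3 \<and> b' = dig n 2"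
        "d' \<noteq> 0 \<longrightarrow> a' = dig n 3 \<and> b' = dig n 2 \<and> c' = dig n 1"
      by (rule truncationsE)
    have "a + a' \<le> dig n 3"
    proof (rule ccontr)
      assume "\<not> a + a' \<le> dig n 3"
      then have "(dig n 3 + 1) * n ^ 3 \<le> (a + a') * n ^ 3" using n by (intro mult_right_mono) auto
      moreover have "0 \<le> b * n ^ 2" "0 \<le> c * n" "0 \<le> b' * n ^ 2" "0 \<le> c' * n"
        using d d' n by auto
      ultimately show False
        using le t s' tail3 d d' digits(1) by (simp add: algebra_simps)
    qed
    then have "a \<noteq> dig n 3" "a' \<noteq> dig n 3" using d d' by auto
    then have "t = a * n ^ 3" "s = a' * n ^ 3" using full full' t s' by auto
    moreover from this have "s + t = (a' + a) * n ^ 3" by (simp add: algebra_simps)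
    ultimately show ?thesis
      by (simp only: eval_digits_basic[OF n]) (simp add: algebra_simps)
  qed
qed

lemma J_nonneg_cases:
  assumes "t \<in> J_nonneg n"
  obtains "t = 0" | "t = 1" | "t = n" | "t = n ^ 2" | "t \<in> truncations n"
  using assms by (auto simp: J_nonneg_def)

lemma J_nonneg_bounds:
  assumes n: "n \<ge> 3" and t: "t \<in> J_nonneg n"
  shows "0 \<le> t" "t \<le> 2 ^ rho n"
proof -
  have "n ^ 1 \<le> n ^ 3" "n ^ 2 \<le> n ^ 3" using n by (intro power_increasing; simp)+
  moreover have "n ^ 3 \<le> 2 ^ rho n" by (rule rho_bounds(1)[OF n])
  ultimately have "n \<le> 2 ^ rho n" "n ^ 2 \<le> 2 ^ rho n" by simp_all
  moreover have "0 < n ^ 3" using n by simp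
  then have "0 \<le> t" if "n ^ 3 \<le> t" using that by linarith
  ultimately show "0 \<le> t" "t \<le> 2 ^ rho n"
    using t truncations_bounds[OF n, of t] n by (auto elim!: J_nonneg_cases)
qed

text \<open>Sums of two of the isolated elements \<open>1\<close>, \<open>n\<close>, \<open>n\<^sup>2\<close> never belong to the set when
  \<open>n \<ge> 3\<close>, so the previous lemma covers every genuine case.\<close>

lemma eval_digits_add:
  assumes n: "n \<ge> 3" and "s \<in> J_nonneg n" "t \<in> J_nonneg n" "s + t \<in> J_nonneg n"
  shows "eval_digits n x (s + t) = eval_digits n x s + eval_digits n x t"
proof -
  have le: "s + t \<le> 2 ^ rho n" using J_nonneg_bounds[OF n assms(4)] by simp
  consider "t \<in> truncations n" | "s \<in> truncations n" | "s = 0" | "t = 0"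
    | "s \<in> {1, n, n ^ 2}" "t \<in> {1, n, n ^ 2}"
    using assms by (auto simp: J_nonneg_def)
  then show ?thesis
  proof cases
    case 1
    then show ?thesis
      using eval_digits_add_truncation[OF n 1 _ le] assms by (simp add: J_nonneg_def)
  next
    case 2
    then show ?thesis
      using eval_digits_add_truncation[OF n 2, of t x] assms le
      by (simp add: J_nonneg_def add.commute)
  next
    case 5
    have q: "3 * n \<le> n ^ 2" "3 * n ^ 2 \<le> n ^ 3"
      using n by (auto simp: power2_eq_square power3_eq_cube intro!: mult_right_mono)
    have "s + t \<notin> {0, 1, n, n ^ 2}" using 5 n q by auto
    moreover have "s + t < n ^ 3" using 5 n q by auto
    ultimately show ?thesis
      using assms(4) truncations_bounds(1)[OF n, of "s + t"] by (auto simp: J_nonneg_def)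
  qed (simp_all add: eval_digits_basic[OF n])
qed

text \<open>As all elements lie below \<open>n ^ 4\<close>, the only products without a factor \<open>0\<close> or \<open>1\<close> are
  \<open>n * n\<close> and \<open>n * n\<^sup>2\<close>.\<close>

lemma eval_digits_mult:
  assumes n: "n \<ge> 3" and s: "s \<in> J_nonneg n" and t: "t \<in> J_nonneg n" and st: "s * t \<in> J_nonneg n"
  shows "eval_digits n x (s * t) = eval_digits n x s * eval_digits n x t"
proof -
  have lt: "s * t < n ^ 4" using J_nonneg_bounds[OF n st] rho_bounds(2)[OF n] by simp
  have "n ^ 1 \<le> n ^ 3" "n ^ 2 \<le> n ^ 3" "n ^ 1 \<le> n ^ 2"
    using n by (intro power_increasing; simp)+
  then have size: "u = 0 \<or> u = 1 \<or> n ^ 1 \<le> u" "u = 0 \<or> u = 1 \<or> u = n \<or> n ^ 2 \<le> u"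
    "u = 0 \<or> u = 1 \<or> u = n \<or> u = n ^ 2 \<or> n ^ 3 \<le> u" if "u \<in> J_nonneg n" for u
    using that truncations_bounds(1)[OF n, of u] by (auto elim!: J_nonneg_cases)
  note basic = eval_digits_basic[OF n, of x]
  have cube: "eval_digits n x (n ^ 3) = x ^ 3" using eval_digits_basic(5)[OF n, of x 1] by simp
  have prod: "n ^ (i + j) \<le> s * t" if "n ^ i \<le> s" "n ^ j \<le> t" for i j
    using mult_mono[OF that] n J_nonneg_bounds[OF n s] by (simp add: power_add)
  consider "s = 0" | "t = 0" | "s = 1" | "t = 1" | "s = n" "t = n" | "s = n" "t = n ^ 2"
    | "s = n ^ 2" "t = n" | "n ^ 2 \<le> s" "n ^ 2 \<le> t" | "n ^ 1 \<le> s" "n ^ 3 \<le> t"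
    | "n ^ 3 \<le> s" "n ^ 1 \<le> t"
    using size[OF s] size[OF t] by blast
  then show ?thesis
  proof cases
    case 5
    then show ?thesis
      using eval_digits_basic[OF n, of x] by (simp add: power2_eq_square)
  next
    case 6
    then have st: "s * t = n ^ 3" by (simp add: power2_eq_square power3_eq_cube)
    then show ?thesis
      unfolding st unfolding cube unfolding 6 basic by (simp add: power2_eq_square power3_eq_cube)
  next
    case 7
    then have st: "s * t = n ^ 3" by (simp add: power2_eq_square power3_eq_cube)
    then show ?thesis
      unfolding st unfolding cube unfolding 7 basic by (simp add: power2_eq_square power3_eq_cube)
  next
    case 8
    then show ?thesis using prod[of 2 2] lt by simp
  next
    case 9
    then show ?thesis using prod[of 1 3] lt by simp
  next
    case 10
    then show ?thesis using prod[of 3 1] lt by simp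
  qed (simp_all add: eval_digits_basic[OF n])
qed

lemma dvd_power_of_2_int:
  fixes s :: int
  assumes "s dvd 2 ^ i" "s > 0"
  obtains k where "s = 2 ^ k"
proof -
  have "nat s dvd 2 ^ i" using assms by (simp add: nat_dvd_iff)
  then obtain k where "nat s = 2 ^ k"
    using divides_primepow_nat[of 2 "nat s" i] by auto
  then have "int (nat s) = int (2 ^ k)" by (simp only:)
  then have "s = 2 ^ k" using assms(2) by simp
  then show ?thesis by (rule that)
qed

text \<open>Here the hypothesis on \<open>n\<close> enters: neither \<open>n\<close> nor \<open>n\<^sup>2\<close> divides a power of two, and a power
  of two that is at least \<open>n ^ 3\<close> is at least \<open>2 ^ rho n\<close> by minimality of \<open>rho n\<close>.\<close>

lemma J_nonneg_dvd_power_of_2: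
  assumes n: "n \<ge> 3" and not_pow: "n \<notin> {2 ^ k | k. k \<ge> 2}"
    and s: "s \<in> J_nonneg n" "s > 0" "s dvd 2 ^ i"
  shows "s = 1 \<or> s = 2 ^ rho n"
proof -
  have not_dvd: "\<not> n dvd s"  if "s < n ^ 3"
  proof
    assume "n dvd s"
    then have "n dvd 2 ^ i" using s(3) dvd_trans by blast
    then obtain k where k: "n = 2 ^ k" using n by (elim dvd_power_of_2_int) auto
    have "k \<ge> 2"
    proof (rule ccontr)
      assume "\<not> k \<ge> 2"
      then have "k = 0 \<or> k = 1" by linarith
      then show False using k n by auto
    qed
    then show False using not_pow k by blast
  qed
  have "n < n ^ 3" "n ^ 2 < n ^ 3" using n power_strict_increasing[of 1 3 n] by auto
  then have "s = 1 \<or> n ^ 3 \<le> s"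
    using s not_dvd truncations_bounds(1)[OF n] by (auto elim!: J_nonneg_cases simp: not_le)
  moreover have "s = 2 ^ rho n" if "n ^ 3 \<le> s"
  proof -
    obtain k where k: "s = 2 ^ k" using s by (elim dvd_power_of_2_int)
    have "rho n \<le> k" unfolding rho_def using that k by (auto intro: Least_le)
    then have "2 ^ rho n \<le> s" unfolding k by (intro power_increasing) auto
    then show ?thesis using J_nonneg_bounds[OF n s(1)] by simp
  qed
  ultimately show ?thesis by blast
qed

text \<open>Since \<open>of_rat\<close> is an injective ring homomorphism, a map on the embedded copy of \<open>A\<close> may be
  constructed on the rational numbers, where the order and the floor function are available.\<close>

lemma arithmetic_map_of_rat_image:
  fixes F :: "rat \<Rightarrow> 'a::field_char_0"
  assumes "F 1 = 1"
    and "\<And>p q. p \<in> A \<Longrightarrow> q \<in> A \<Longrightarrow> p + q \<in> A \<Longrightarrow> F (p + q) = F p + F q"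
    and "\<And>p q. p \<in> A \<Longrightarrow> q \<in> A \<Longrightarrow> p * q \<in> A \<Longrightarrow> F (p * q) = F p * F q"
  shows "arithmetic_map (of_rat ` A) (F \<circ> inv of_rat)"
proof -
  have "inj (of_rat :: rat \<Rightarrow> 'a)" by (simp add: inj_def)
  then have inv: "inv of_rat (of_rat p :: 'a) = p" for p by simp
  have "inv of_rat (1 :: 'a) = 1" using inv[of 1] by simp
  then show ?thesis
    using assms
    by (auto simp: arithmetic_map_def inv image_iff simp flip: of_rat_add of_rat_mult)
qed

lemma arithmetic_map_of_digit_equation:
  fixes x :: "'a::field_char_0"
  assumes n: "n \<ge> 3" and not_pow: "n \<notin> {2 ^ k | k. k \<ge> 2}" and x: "digit_equation n x"
  obtains f where "arithmetic_map (of_rat ` J n) f" "f (of_int n) = x"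
proof -
  define F :: "rat \<Rightarrow> 'a"
    where "F q = (if q < 0 then of_rat q else eval_digits n x \<lfloor>q\<rfloor>)" for q
  have Fneg: "F q = of_rat q" if "q < 0" for q using that by (simp add: F_def)
  have Fint: "F (of_int s) = eval_digits n x s" if "s \<in> J_nonneg n" for s
    using J_nonneg_bounds[OF n that] by (simp add: F_def)
  have one: "1 \<in> J_nonneg n" by (simp add: J_nonneg_def)
  note basic = eval_digits_basic[OF n, of x]
  have cases: "(\<exists>s\<in>J_nonneg n. q = of_int s) \<or> (\<exists>i\<le>rho n. q = - (1 / 2 ^ i))" if "q \<in> J n" for q
    using that J_subset[OF n] by auto
  have nonneg_int: "\<exists>s\<in>J_nonneg n. q = of_int s" if "q \<in> J n" "q \<ge> 0" for q
  proof -
    have "- (1 / 2 ^ i) < (0 :: rat)" for i :: nat by simp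
    then show ?thesis using cases[OF that(1)] that(2) by (metis not_le)
  qed
  have neg_pow: "\<exists>i. q = - (1 / 2 ^ i)" if "q \<in> J n" "q < 0" for q
    using cases[OF that(1)] that(2) J_nonneg_bounds(1)[OF n] by force
  have neg_ge: "- 1 \<le> q" if "q \<in> J n" "q < 0" for q
  proof -
    from neg_pow[OF that] obtain i where "q = - (1 / 2 ^ i)" by blast
    then show ?thesis by simp
  qed

  \<comment> \<open>If the sum stays negative, then \<open>q = 0\<close>. Otherwise \<open>p\<close> is an integer, so the sum is a step
    \<open>s - 1 = t\<close> and follows from \<open>t + 1 = s\<close>.\<close>
  have add_mixed: "F (p + q) = F p + F q"
    if mem: "p \<in> J n" "q \<in> J n" "p + q \<in> J n" and p: "p < 0" and q: "q \<ge> 0" for p q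
  proof -
    obtain s where s: "s \<in> J_nonneg n" "q = of_int s" using nonneg_int mem q by blast
    show ?thesis
    proof (cases "p + q < 0")
      case True
      then have "q < 1" using neg_ge[OF mem(1) p] by linarith
      then have "s = 0" using s q by simp
      then show ?thesis using Fneg[OF p] s Fint[OF s(1)] basic by simp
    next
      case False
      then obtain t where t: "t \<in> J_nonneg n" "p + q = of_int t"
        using nonneg_int[OF mem(3)] by auto
      have pi: "p = of_int (t - s)" using t s by simp
      then have "t - s = - 1" using neg_ge[OF mem(1) p] p by linarith
      then have st: "s = t + 1" and p1: "p = - 1" using pi by auto
      have "eval_digits n x s = eval_digits n x t + 1"
        using eval_digits_add[OF n t(1) one, of x] s(1) basic(2) unfolding st by simp
      moreover have "F p = - 1" using Fneg[OF p] p1 by (simp add: of_rat_minus)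
      ultimately show ?thesis
        unfolding t(2) unfolding s(2) Fint[OF s(1)] Fint[OF t(1)] by simp
    qed
  qed
  have add: "F (p + q) = F p + F q" if mem: "p \<in> J n" "q \<in> J n" "p + q \<in> J n" for p q
  proof -
    consider "p < 0" "q < 0" | "p < 0" "q \<ge> 0" | "p \<ge> 0" "q < 0" | "p \<ge> 0" "q \<ge> 0"
      by linarith
    then show ?thesis
    proof cases
      case 1
      then show ?thesis by (simp add: Fneg of_rat_add)
    next
      case 2
      then show ?thesis using add_mixed mem by blast
    next
      case 3
      then show ?thesis using add_mixed[of q p] mem by (simp add: add.commute)
    next
      case 4
      then obtain s t where "s \<in> J_nonneg n" "p = of_int s" "t \<in> J_nonneg n" "q = of_int t"
        using nonneg_int mem by metis
      moreover have "s + t \<in> J_nonneg n"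
        using nonneg_int[OF mem(3)] 4 calculation by (auto simp flip: of_int_add)
      ultimately show ?thesis
        using eval_digits_add[OF n, of s t x] Fint[of "s + t"] by (simp add: Fint)
    qed
  qed

  \<comment> \<open>A nonzero product is again a negative dyadic fraction, so \<open>q\<close> divides a power of two.\<close>
  have mult_mixed: "F (p * q) = F p * F q"
    if mem: "p \<in> J n" "q \<in> J n" "p * q \<in> J n" and p: "p < 0" and q: "q \<ge> 0" for p q
  proof -
    obtain s where s: "s \<in> J_nonneg n" "q = of_int s" using nonneg_int mem q by blast
    show ?thesis
    proof (cases "s = 0")
      case True
      then show ?thesis using s Fint[OF s(1)] basic by simp
    next
      case False
      then have s0: "s > 0" using s q by simp
      then have pq: "p * q < 0" using p s by (simp add: mult_neg_pos)
      obtain i j where i: "p = - (1 / 2 ^ i)" and j: "p * q = - (1 / 2 ^ j)"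
        using neg_pow mem p pq by metis
      have "- (1 / 2 ^ i) * of_int s = (- (1 / 2 ^ j) :: rat)" using j unfolding i s(2) .
      then have "of_int (s * 2 ^ j) = (of_int (2 ^ i) :: rat)"
        by (simp add: field_simps)
      then have "s * 2 ^ j = 2 ^ i" by (simp only: of_int_eq_iff)
      then have "s dvd 2 ^ i" by (metis dvd_triv_left)
      then have "s = 1 \<or> s = 2 ^ rho n" by (rule J_nonneg_dvd_power_of_2[OF n not_pow s(1) s0])
      then have "eval_digits n x s = of_int s" using basic(2) eval_digits_rho[OF n x] by auto
      then show ?thesis
        using Fneg[OF p] Fneg[OF pq] Fint[OF s(1)] s(2) by (simp add: of_rat_mult)
    qed
  qed
  have mult: "F (p * q) = F p * F q" if mem: "p \<in> J n" "q \<in> J n" "p * q \<in> J n" for p q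
  proof -
    consider "p < 0" "q < 0" | "p < 0" "q \<ge> 0" | "p \<ge> 0" "q < 0" | "p \<ge> 0" "q \<ge> 0"
      by linarith
    then show ?thesis
    proof cases
      case 1
      \<comment> \<open>Both factors are at least \<open>-1\<close>, so their product is a positive integer not exceeding \<open>1\<close>.\<close>
      then have pos: "p * q > 0" by (simp add: mult_neg_neg)
      then obtain t where t: "t \<in> J_nonneg n" "p * q = of_int t" using nonneg_int mem(3) by force
      have "(- p) * (- q) \<le> 1 * 1"
        using neg_ge[OF mem(1)] neg_ge[OF mem(2)] 1 by (intro mult_mono) auto
      then have "t = 1" using t pos by simp
      then show ?thesis
        using 1 t Fint[OF t(1)] basic by (simp add: Fneg flip: of_rat_mult)
    next
      case 2
      then show ?thesis using mult_mixed mem by blast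
    next
      case 3
      then show ?thesis using mult_mixed[of q p] mem by (simp add: mult.commute)
    next
      case 4
      then obtain s t where "s \<in> J_nonneg n" "p = of_int s" "t \<in> J_nonneg n" "q = of_int t"
        using nonneg_int mem by metis
      moreover have "s * t \<in> J_nonneg n"
        using nonneg_int[OF mem(3)] 4 calculation by (auto simp flip: of_int_mult)
      ultimately show ?thesis
        using eval_digits_mult[OF n, of s t x] Fint[of "s * t"] by (simp add: Fint)
    qed
  qed

  have "F 1 = 1" using Fint[OF one] basic by simp
  then have "arithmetic_map (of_rat ` J n) (F \<circ> inv of_rat)"
    using add mult by (rule arithmetic_map_of_rat_image)
  moreover have "inv of_rat (of_int n :: 'a) = of_int n"
    using inv_f_f[of "of_rat :: rat \<Rightarrow> 'a" "of_int n"] by (simp add: inj_def)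
  then have "(F \<circ> inv of_rat) (of_int n :: 'a) = x"
    using Fint[of n] basic by (simp add: J_nonneg_def)
  ultimately show ?thesis by (rule that)
qed

section \<open>The roots of the digit equation\<close>

lemma digit_equation_factor:
  fixes x :: "'a::field_char_0"
  assumes n: "n \<ge> 3"
  shows "digit_equation n x \<longleftrightarrow> x = of_int n \<or>
    of_int (dig n 3) * x ^ 2 + of_int (dig n 2 + dig n 3 * n) * x
      + of_int (dig n 1 + dig n 2 * n + dig n 3 * n ^ 2) = 0" (is "_ \<longleftrightarrow> _ \<or> ?q = 0")
proof -
  have "(2 :: 'a) ^ rho n = of_int (2 ^ rho n)" by simp
  also have "\<dots> = of_int (dig n 3) * of_int n ^ 3 + of_int (dig n 2) * of_int n ^ 2
      + of_int (dig n 1) * of_int n + of_int (dig n 0)"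
    unfolding rho_expansion(1)[OF n] by simp
  finally have "digit_equation n x \<longleftrightarrow> (x - of_int n) * ?q = 0"
    unfolding digit_equation_def
    by (simp add: algebra_simps power2_eq_square power3_eq_cube)
  then show ?thesis by simp
qed

text \<open>Completing the square: \<open>4 m\<^sub>3\<close> times the quadratic is a square plus
  \<open>(3 m\<^sub>3 n - m\<^sub>2) (m\<^sub>2 + m\<^sub>3 n) + 4 m\<^sub>1 m\<^sub>3\<close>, which is positive as \<open>m\<^sub>2 < n \<le> m\<^sub>3 n\<close>.\<close>

lemma digit_cofactor_pos:
  fixes x :: "'a::linordered_field"
  assumes n: "n \<ge> 3"
  shows "0 < of_int (dig n 3) * x ^ 2 + of_int (dig n 2 + dig n 3 * n) * x
      + of_int (dig n 1 + dig n 2 * n + dig n 3 * n ^ 2)" (is "0 < ?q")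
proof -
  note digits = rho_expansion[OF n]
  let ?m1 = "dig n 1" and ?m2 = "dig n 2" and ?m3 = "dig n 3"
  have m3n: "n \<le> ?m3 * n" using n digits mult_right_mono[of 1 ?m3 n] by simp
  have m2: "0 \<le> ?m2" "?m2 < n" using digits by auto
  have "0 < (3 * (?m3 * n) - ?m2) * (?m2 + ?m3 * n)" using n m2 m3n by (intro mult_pos_pos; linarith)
  moreover have "0 \<le> 4 * ?m1 * ?m3" using digits by simp
  ultimately have "0 < (3 * (?m3 * n) - ?m2) * (?m2 + ?m3 * n) + 4 * ?m1 * ?m3" (is "0 < ?D")
    by linarith
  then have D: "(0 :: 'a) < of_int ?D" by (simp only: of_int_0_less_iff)
  have "4 * of_int ?m3 * ?q = (2 * of_int ?m3 * x + of_int (?m2 + ?m3 * n)) ^ 2 + of_int ?D"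
    by (simp add: algebra_simps power2_eq_square)
  also have "\<dots> > 0" using D by (intro add_nonneg_pos) auto
  finally show ?thesis using digits(2) by (simp add: zero_less_mult_iff)
qed

lemma digit_equation_ordered_field:
  fixes x :: "'a::linordered_field"
  assumes "n \<ge> 3"
  shows "digit_equation n x \<longleftrightarrow> x = of_int n"
  using digit_equation_factor[OF assms, of x] digit_cofactor_pos[OF assms, of x] by auto

lemma quadratic_root_complex:
  fixes a b c :: complex
  assumes "a \<noteq> 0"
  obtains z where "a * z ^ 2 + b * z + c = 0"
proof -
  define w where "w = csqrt (b ^ 2 - 4 * a * c)"
  define z where "z = (w - b) / (2 * a)"
  have "4 * a * (a * z ^ 2 + b * z + c) = (2 * a * z + b) ^ 2 - (b ^ 2 - 4 * a * c)"
    by (simp add: algebra_simps power2_eq_square)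
  also have "2 * a * z + b = w" using assms by (simp add: z_def)
  also have "w ^ 2 = b ^ 2 - 4 * a * c" by (simp add: w_def)
  finally have "a * z ^ 2 + b * z + c = 0" using assms by simp
  then show ?thesis by (rule that)
qed

text \<open>A complex root of the quadratic factor differs from \<open>n\<close>, as the factor is positive at every
  real number.\<close>

lemma digit_equation_complex:
  assumes n: "n \<ge> 3"
  obtains z :: complex where "digit_equation n z" "z \<noteq> of_int n"
proof -
  have "(of_int (dig n 3) :: complex) \<noteq> 0" using rho_expansion(2)[OF n] by simp
  then obtain z :: complex where z: "of_int (dig n 3) * z ^ 2 + of_int (dig n 2 + dig n 3 * n) * z
      + of_int (dig n 1 + dig n 2 * n + dig n 3 * n ^ 2) = 0"
    by (rule quadratic_root_complex)
  have "z \<noteq> of_int n"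
  proof
    assume "z = of_int n"
    then have "complex_of_real (of_int (dig n 3) * of_int n ^ 2 + of_int (dig n 2 + dig n 3 * n) * of_int n
      + of_int (dig n 1 + dig n 2 * n + dig n 3 * n ^ 2)) = 0"
      using z by simp
    then show False using digit_cofactor_pos[OF n, of "of_int n :: real"]
      by (simp only: of_real_eq_0_iff)
  qed
  moreover have "digit_equation n z" using z digit_equation_factor[OF n] by blast
  ultimately show ?thesis using that by blast
qed

section \<open>The set J(n) as an arithmetic neighbourhood\<close>

lemma finite_J:
  assumes "n \<ge> 3"
  shows "finite (J n)"
proof (rule finite_subset[OF J_subset[OF assms]])
  have "J_nonneg n \<subseteq> {0..2 ^ rho n}" using J_nonneg_bounds[OF assms] by auto
  then show "finite (of_int ` J_nonneg n \<union> (\<lambda>i. - (1 / 2 ^ i) :: rat) ` {..rho n})"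
    by (auto intro: finite_subset)
qed

lemma arithmetic_neighbourhood_J_ordered_field:
  assumes n: "n \<ge> 3"
  shows "arithmetic_neighbourhood (of_rat ` J n :: 'a::linordered_field set) (of_int n)"
  unfolding arithmetic_neighbourhood_def
proof (intro conjI allI impI)
  show "finite (of_rat ` J n :: 'a set)" using finite_J[OF n] by simp
  have "of_int n \<in> J n" by (simp add: J_def Let_def)
  then show "of_int n \<in> (of_rat ` J n :: 'a set)" by (metis imageI of_rat_of_int_eq)
next
  fix f :: "'a \<Rightarrow> 'a"
  assume "arithmetic_map (of_rat ` J n) f"
  then show "f (of_int n) = of_int n"
    using digit_equation_of_arithmetic_map[OF n] digit_equation_ordered_field[OF n] by blast
qed

theorem theorem7:
  fixes n :: int
  assumes "n \<ge> 3" and "n \<notin> {2 ^ k | k. k \<ge> 2}"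
  shows "arithmetic_neighbourhood (of_rat ` J n :: real set) (of_int n)
    \<and> arithmetic_neighbourhood (J n) (of_int n)
    \<and> \<not> arithmetic_neighbourhood (of_rat ` J n :: complex set) (of_int n)"
proof (intro conjI)
  show "arithmetic_neighbourhood (of_rat ` J n :: real set) (of_int n)"
    by (rule arithmetic_neighbourhood_J_ordered_field[OF assms(1)])
  show "arithmetic_neighbourhood (J n) (of_int n)"
    using arithmetic_neighbourhood_J_ordered_field[OF assms(1), where 'a = rat] by simp
  obtain z :: complex where z: "digit_equation n z" "z \<noteq> of_int n"
    using assms(1) by (rule digit_equation_complex)
  obtain f where "arithmetic_map (of_rat ` J n) f" "f (of_int n) = z"
    using assms z(1) by (rule arithmetic_map_of_digit_equation)
  with z(2) show "\<not> arithmetic_neighbourhood (of_rat ` J n :: complex set) (of_int n)"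
    by (auto simp: arithmetic_neighbourhood_def)
qed

end
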